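(* Let $G$ be a snark and let $u$ and $v$ be two distinct vertices of $G$. Then the following statements (i)–(iii) are equivalent: (i) $G-\{u,v\}$ is $3$-edge-colourable; (ii) $G-\{u,v\}$ admits a nowhere-zero $4$-flow; (iii) $G/\{u,v\}$ admits a nowhere-zero $4$-flow. If, in addition, $u$ and $v$ are adjacent and joined by an edge $e$, then statements (i)–(iii) are also equivalent to each of the following: (iv) $G-e$ admits a nowhere-zero $4$-flow; (v) $G/e$ admits a nowhere-zero $4$-flow; (vi) $G\sim e$ is $3$-edge-colourable.
   Context: Graphs may have parallel edges and loops, and occasionally dangling edges (edges with only one end-vertex). A snark is a connected cubic graph that admits no proper edge-colouring with three colours (equivalently, no nowhere-zero $4$-flow). For distinct vertices $u,v$ of $G$: $G-\{u,v\}$ denotes the graph obtained from $G$ by removing $u$ and $v$ but retaining the edges formerly incident with them as dangling edges (an edge between $u$ and $v$ disappears); $G/\{u,v\}$ denotes the graph obtained by identifying $u$ and $v$ into a single vertex. For an edge $e$: $G-e$ is the graph obtained by deleting $e$; $G/e$ is the graph obtained by contracting $e$; $G\sim e$ is the cubic graph obtained from $G-e$ by suppressing the two resulting vertices of degree two. A nowhere-zero $4$-flow on a graph (possibly with dangling edges) is an orientation together with an assignment of values from $\{\pm1,\pm2,\pm3\}$ to the edges such that Kirchhoff's law (inflow equals outflow) holds at every vertex; dangling edges are subject to no condition at their free end. *)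

theory Defs
  imports Main "HOL-Library.Multiset"
begin

text \<open>
  Graphs with parallel edges, loops and dangling edges. Each edge carries the multiset of its
  end-vertices: \<open>{#x, y#}\<close> for an edge between \<open>x\<close> and \<open>y\<close> (a loop if \<open>x = y\<close>) and \<open>{#x#}\<close> for a
  dangling edge at \<open>x\<close>. The empty multiset stands for a vertexless circle, which only arises when
  all vertices of a circuit are suppressed.
\<close>

record ('v, 'e) multigraph =
  verts :: "'v set"
  edges :: "'e set"
  ends :: "'e \<Rightarrow> 'v multiset"

definition finite_graph :: "('v, 'e) multigraph \<Rightarrow> bool" where
  "finite_graph G \<longleftrightarrow> finite (verts G) \<and> finite (edges G) \<and>
     (\<forall>e \<in> edges G. set_mset (ends G e) \<subseteq> verts G \<and> size (ends G e) \<le> 2)"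

definition no_dangling_edges :: "('v, 'e) multigraph \<Rightarrow> bool" where
  "no_dangling_edges G \<longleftrightarrow> (\<forall>e \<in> edges G. size (ends G e) = 2)"

definition degree :: "('v, 'e) multigraph \<Rightarrow> 'v \<Rightarrow> nat" where
  "degree G x = (\<Sum>e \<in> edges G. count (ends G e) x)"

definition cubic :: "('v, 'e) multigraph \<Rightarrow> bool" where
  "cubic G \<longleftrightarrow> (\<forall>x \<in> verts G. degree G x = 3)"

definition connected_graph :: "('v, 'e) multigraph \<Rightarrow> bool" where
  "connected_graph G \<longleftrightarrow> verts G \<noteq> {} \<and>
     (\<forall>x \<in> verts G. \<forall>y \<in> verts G. (x, y) \<in> {(a, b). \<exists>e \<in> edges G. ends G e = {#a, b#}}\<^sup>*)"

text \<open>A loop is adjacent to itself, so a graph with a loop has no proper edge-colouring.\<close>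

definition adjacent_edges :: "('v, 'e) multigraph \<Rightarrow> 'e \<Rightarrow> 'e \<Rightarrow> bool" where
  "adjacent_edges G a b \<longleftrightarrow>
     (a \<noteq> b \<and> (\<exists>x. x \<in># ends G a \<and> x \<in># ends G b)) \<or> (a = b \<and> (\<exists>x. ends G a = {#x, x#}))"

definition edge_colourable :: "nat \<Rightarrow> ('v, 'e) multigraph \<Rightarrow> bool" where
  "edge_colourable k G \<longleftrightarrow> (\<exists>c :: 'e \<Rightarrow> nat. (\<forall>e \<in> edges G. c e < k) \<and>
     (\<forall>a \<in> edges G. \<forall>b \<in> edges G. adjacent_edges G a b \<longrightarrow> c a \<noteq> c b))"

definition snark :: "('v, 'e) multigraph \<Rightarrow> bool" where
  "snark G \<longleftrightarrow> finite_graph G \<and> no_dangling_edges G \<and> connected_graph G \<and> cubic G \<and>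
     \<not> edge_colourable 3 G"

text \<open>
  An orientation gives every edge a tail and a head; \<open>None\<close> is the free end of a dangling edge,
  where Kirchhoff's law is not imposed.
\<close>

definition orientation ::
  "('v, 'e) multigraph \<Rightarrow> ('e \<Rightarrow> 'v option) \<Rightarrow> ('e \<Rightarrow> 'v option) \<Rightarrow> bool" where
  "orientation G tail head \<longleftrightarrow>
     (\<forall>e \<in> edges G. ends G e = mset_set (set_option (tail e)) + mset_set (set_option (head e)))"

definition has_nowhere_zero_flow :: "nat \<Rightarrow> ('v, 'e) multigraph \<Rightarrow> bool" where
  "has_nowhere_zero_flow k G \<longleftrightarrow> (\<exists>tail head. \<exists>f :: 'e \<Rightarrow> int.
     orientation G tail head \<and>
     (\<forall>e \<in> edges G. f e \<noteq> 0 \<and> \<bar>f e\<bar> < int k) \<and>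
     (\<forall>x \<in> verts G. (\<Sum>e | e \<in> edges G \<and> head e = Some x. f e) =
                    (\<Sum>e | e \<in> edges G \<and> tail e = Some x. f e)))"

text \<open>
  \<open>G - S\<close>: edges with just one end in \<open>S\<close> stay as dangling edges; edges with no end outside \<open>S\<close>
  (those joining members of \<open>S\<close>, and loops) disappear.
\<close>

definition remove_vertices :: "('v, 'e) multigraph \<Rightarrow> 'v set \<Rightarrow> ('v, 'e) multigraph" where
  "remove_vertices G S =
     \<lparr>verts = verts G - S,
      edges = {e \<in> edges G. \<not> set_mset (ends G e) \<subseteq> S},
      ends = (\<lambda>e. filter_mset (\<lambda>x. x \<notin> S) (ends G e))\<rparr>"

text \<open>
  \<open>G / S\<close>: an arbitrary member of \<open>S\<close> serves as the vertex into which \<open>S\<close> is identified. All edges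
  are kept; those between members of \<open>S\<close> become loops.
\<close>

definition identify_vertices :: "('v, 'e) multigraph \<Rightarrow> 'v set \<Rightarrow> ('v, 'e) multigraph" where
  "identify_vertices G S =
     (let r = (\<lambda>x. if x \<in> S then (SOME s. s \<in> S) else x) in
      \<lparr>verts = r ` verts G,
       edges = edges G,
       ends = (\<lambda>e. image_mset r (ends G e))\<rparr>)"

definition delete_edge :: "('v, 'e) multigraph \<Rightarrow> 'e \<Rightarrow> ('v, 'e) multigraph" where
  "delete_edge G e = \<lparr>verts = verts G, edges = edges G - {e}, ends = ends G\<rparr>"

definition contract_edge :: "('v, 'e) multigraph \<Rightarrow> 'e \<Rightarrow> ('v, 'e) multigraph" where
  "contract_edge G e = identify_vertices (delete_edge G e) (set_mset (ends G e))"

text \<open>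
  Suppressing a set \<open>W\<close> of vertices of degree two merges every maximal path whose inner vertices
  lie in \<open>W\<close> into one edge. The new edge is represented by the set of edges of that path; its ends
  are the ends of the path, that is, the end-vertices of its edges that lie outside \<open>W\<close>.
\<close>

definition suppress_vertices :: "('v, 'e) multigraph \<Rightarrow> 'v set \<Rightarrow> ('v, 'e set) multigraph" where
  "suppress_vertices G W =
     \<lparr>verts = verts G - W,
      edges = edges G // {(a, b). a \<in> edges G \<and> b \<in> edges G \<and>
                                  (\<exists>w \<in> W. w \<in># ends G a \<and> w \<in># ends G b)}\<^sup>*,
      ends = (\<lambda>C. \<Sum>a \<in> C. filter_mset (\<lambda>x. x \<notin> W) (ends G a))\<rparr>"

text \<open>
  \<open>G \<sim> e\<close>: if \<open>G\<close> is cubic and \<open>e\<close> is not a loop, the vertices of degree two in \<open>G - e\<close> are exactly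
  the two ends of \<open>e\<close>.
\<close>

definition delete_suppress :: "('v, 'e) multigraph \<Rightarrow> 'e \<Rightarrow> ('v, 'e set) multigraph" where
  "delete_suppress G e =
     suppress_vertices (delete_edge G e) {x \<in> verts G. degree (delete_edge G e) x = 2}"

end

theory Submission
  imports Defs
begin

text \<open>
  All six statements are rephrased in terms of colourings of the edges by \<open>0, 1, 2\<close> for which the
  numbers \<open>n\<^sub>0(x), n\<^sub>1(x), n\<^sub>2(x)\<close> of edge-ends of each colour at \<open>x\<close> have the same parity, that is,
  nowhere-zero \<open>\<int>\<^sub>2 \<times> \<int>\<^sub>2\<close>-flows. By Tutte's argument they exist exactly when there is a nowhere-zero
  4-flow, and at a vertex of degree three the parity condition says that the three colours are
  distinct. Since every colour class has an even number of edge-ends, the condition at a vertex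
  obtained by identification holds as soon as it holds at all other vertices. If \<open>e\<close> joins \<open>u\<close> and
  \<open>v\<close> and the condition holds in \<open>G - e\<close> everywhere except at \<open>u\<close> or \<open>v\<close>, then the two edge-ends at
  \<open>u\<close> carry the same two distinct colours as those at \<open>v\<close>; giving \<open>e\<close> the third colour would
  colour the snark \<open>G\<close>.
\<close>

section \<open>Eulerian orientations of systems of arcs\<close>

definition arc_vector :: "('v \<Rightarrow> int) \<Rightarrow> bool" where
  "arc_vector d \<longleftrightarrow> (\<exists>a b. d = (\<lambda>x. of_bool (a = Some x) - of_bool (b = Some x)))"

text \<open>Both entries at \<open>x\<close> are 1 or -1, so their product records whether the two
  arcs have the same direction at \<open>x\<close>. Taking the second arc with the opposite of that
  sign cancels \<open>x\<close>; what is left runs between the two remaining ends. Either of these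
  may be \<open>None\<close>, which covers dangling edges without a separate argument.\<close>

lemma arc_vector_cancel:
  assumes "arc_vector d" "arc_vector d'" "d x \<noteq> 0" "d' x \<noteq> 0"
  shows "arc_vector (\<lambda>y. d y - d x * d' x * d' y)"
proof -
  obtain a b where d: "d = (\<lambda>x. of_bool (a = Some x) - of_bool (b = Some x))"
    using assms unfolding arc_vector_def by blast
  obtain a' b' where d': "d' = (\<lambda>x. of_bool (a' = Some x) - of_bool (b' = Some x))"
    using assms unfolding arc_vector_def by blast
  have ab: "(a = Some x) \<noteq> (b = Some x)" "(a' = Some x) \<noteq> (b' = Some x)"
    using assms d d' by auto
  consider "a = Some x" "b \<noteq> Some x" "a' = Some x" "b' \<noteq> Some x"
    | "a = Some x" "b \<noteq> Some x" "a' \<noteq> Some x" "b' = Some x"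
    | "a \<noteq> Some x" "b = Some x" "a' = Some x" "b' \<noteq> Some x"
    | "a \<noteq> Some x" "b = Some x" "a' \<noteq> Some x" "b' = Some x"
    using ab by blast
  then show ?thesis
  proof cases
    case 1
    then show ?thesis unfolding arc_vector_def d d'
      by (intro exI[of _ b'] exI[of _ b]) auto
  next
    case 2
    then show ?thesis unfolding arc_vector_def d d'
      by (intro exI[of _ a'] exI[of _ b]) auto
  next
    case 3
    then show ?thesis unfolding arc_vector_def d d'
      by (intro exI[of _ a] exI[of _ b']) auto
  next
    case 4
    then show ?thesis unfolding arc_vector_def d d'
      by (intro exI[of _ a] exI[of _ a']) auto
  qed
qed

lemma arc_vector_values: "arc_vector d \<Longrightarrow> d x = 0 \<or> d x = 1 \<or> d x = -1"
  unfolding arc_vector_def by (auto simp: of_bool_def split: if_splits)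

text \<open>
  An Eulerian orientation, by splitting off: two arcs that meet in \<open>x\<close> are merged into one arc
  that avoids \<open>x\<close>.
\<close>

lemma even_arcs_balanced_signs:
  fixes d :: "'e \<Rightarrow> 'v \<Rightarrow> int"
  assumes "finite A" "\<And>e. e \<in> A \<Longrightarrow> arc_vector (d e)" "\<And>x. even (\<Sum>e\<in>A. d e x)"
  shows "\<exists>s :: 'e \<Rightarrow> int. (\<forall>e. s e = 1 \<or> s e = -1) \<and> (\<forall>x. (\<Sum>e\<in>A. s e * d e x) = 0)"
  using assms
\<comment> \<open>The vectors \<open>d\<close> must vary as well, since the merged arc takes over
  the name of one of the two arcs that it replaces.\<close>
proof (induction "card A" arbitrary: A d)
  case 0
  then show ?case by (intro exI[of _ "\<lambda>_. 1"]) auto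
next
  case (Suc n)
  show ?case
  proof (cases "\<forall>e\<in>A. \<forall>x. d e x = 0")
    case True
    then show ?thesis by (intro exI[of _ "\<lambda>_. 1"]) auto
  next
    case False
    then obtain e x where e: "e \<in> A" "d e x \<noteq> 0" by blast
    have fin: "finite (A - {e})" and finA: "finite A" using Suc by auto
    \<comment> \<open>The sum at \<open>x\<close> is even and \<open>e\<close> contributes an odd
      entry, so some other arc \<open>b\<close> also has an odd entry at \<open>x\<close>.\<close>
    have "odd (d e x)" using arc_vector_values[OF Suc.prems(2)[OF e(1)], of x] e by auto
    moreover have "(\<Sum>a\<in>A. d a x) = d e x + (\<Sum>a\<in>A - {e}. d a x)"
      using e finA by (simp add: sum.remove)
    ultimately have "odd (\<Sum>a\<in>A - {e}. d a x)" using Suc.prems(3)[of x] by auto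
    then obtain b where b: "b \<in> A - {e}" "odd (d b x)"
      by (meson dvd_sum)
    \<comment> \<open>The sign for which \<open>d e\<close> and \<open>t * d b\<close> cancel at
      \<open>x\<close>. The merged arc \<open>m\<close> keeps the name \<open>e\<close>, and
      \<open>b\<close> leaves the index set.\<close>
    define t where "t = - (d e x * d b x)"
    have t: "t = 1 \<or> t = -1"
      using arc_vector_values[OF Suc.prems(2)[OF e(1)], of x]
        arc_vector_values[OF Suc.prems(2), of b x] b e unfolding t_def by auto
    define m where "m = (\<lambda>y. d e y + t * d b y)"
    have mrg: "arc_vector m"
    proof -
      have "d b x \<noteq> 0" using b by auto
      then have "arc_vector (\<lambda>y. d e y - d e x * d b x * d b y)"
        using arc_vector_cancel[of "d e" "d b" x] Suc.prems(2) b e by blast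
      then show ?thesis by (simp add: m_def t_def)
    qed
    define B where "B = A - {b}"
    have B: "e \<in> B" "finite B" "card B = n" "A = insert b B" "b \<notin> B"
      using b e Suc by (auto simp: B_def)
    have sumA: "(\<Sum>a\<in>A. g a) = g b + (g e + (\<Sum>a\<in>B - {e}. g a))" for g :: "'e \<Rightarrow> int"
      using B by (simp add: sum.remove[of B e])
    have sumB: "(\<Sum>a\<in>B. g a * (d(e := m)) a y) = g e * m y + (\<Sum>a\<in>B - {e}. g a * d a y)"
      for g :: "'e \<Rightarrow> int" and y
      using B by (simp add: sum.remove[of B e] cong: sum.cong_simp)
    \<comment> \<open>Merging changes the sum at \<open>y\<close> by \<open>(t - 1) * d b y\<close>,
      and \<open>t - 1\<close> is 0 or -2.\<close>
    have ev: "even (\<Sum>a\<in>B. (d(e := m)) a y)" for y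
    proof -
      have "(\<Sum>a\<in>B. (d(e := m)) a y) = (\<Sum>a\<in>A. d a y) + (t - 1) * d b y"
        using sumB[of "\<lambda>_. 1" y] sumA[of "\<lambda>a. d a y"] by (simp add: m_def algebra_simps)
      then show ?thesis using Suc.prems(3)[of y] t by auto
    qed
    have "\<exists>s :: 'e \<Rightarrow> int. (\<forall>a. s a = 1 \<or> s a = -1) \<and>
        (\<forall>y. (\<Sum>a\<in>B. s a * (d(e := m)) a y) = 0)"
    proof (rule Suc.hyps(1))
      show "n = card B" "finite B" using B by auto
      show "arc_vector ((d(e := m)) a)" if "a \<in> B" for a
        using that mrg Suc.prems(2) B by auto
    qed (rule ev)
    then obtain s :: "'e \<Rightarrow> int" where s: "\<forall>a. s a = 1 \<or> s a = -1"
      "\<And>y. (\<Sum>a\<in>B. s a * (d(e := m)) a y) = 0" by blast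
    \<comment> \<open>This undoes the merge: with sign \<open>s e * t\<close> on \<open>b\<close>,
      the arcs \<open>e\<close> and \<open>b\<close> together contribute
      \<open>s e * m\<close>.\<close>
    define s' where "s' = s(b := s e * t)"
    have "(\<Sum>a\<in>A. s' a * d a y) = 0" for y
    proof -
      have "(\<Sum>a\<in>B - {e}. s' a * d a y) = (\<Sum>a\<in>B - {e}. s a * d a y)"
        using B by (intro sum.cong) (auto simp: s'_def)
      moreover have "s' b = s e * t" "s' e = s e" using b by (auto simp: s'_def)
      ultimately show ?thesis
        using s(2)[of y] sumB[of s y] sumA[of "\<lambda>a. s' a * d a y"]
        by (simp add: m_def algebra_simps)
    qed
    moreover have "\<forall>a. s' a = 1 \<or> s' a = -1"
    proof
      fix a show "s' a = 1 \<or> s' a = -1"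
        using s(1)[rule_format, of a] s(1)[rule_format, of e] t by (auto simp: s'_def)
    qed
    ultimately show ?thesis by blast
  qed
qed

section \<open>Nowhere-zero 4-flows and parity colourings\<close>

definition colour_degree :: "('v, 'e) multigraph \<Rightarrow> ('e \<Rightarrow> nat) \<Rightarrow> nat \<Rightarrow> 'v \<Rightarrow> nat" where
  "colour_degree G c i x = (\<Sum>e\<in>{e \<in> edges G. c e = i}. count (ends G e) x)"

text \<open>
  With the colours read as the nonzero elements of \<open>\<int>\<^sub>2 \<times> \<int>\<^sub>2\<close>, the following condition at \<open>x\<close> is
  Kirchhoff's law.
\<close>

definition parity_law :: "('v, 'e) multigraph \<Rightarrow> ('e \<Rightarrow> nat) \<Rightarrow> 'v \<Rightarrow> bool" where
  "parity_law G c x \<longleftrightarrow>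
     (\<forall>i<3. \<forall>j<3. even (colour_degree G c i x) \<longleftrightarrow> even (colour_degree G c j x))"

definition parity_colouring :: "('v, 'e) multigraph \<Rightarrow> ('e \<Rightarrow> nat) \<Rightarrow> bool" where
  "parity_colouring G c \<longleftrightarrow> (\<forall>e \<in> edges G. c e < 3) \<and> (\<forall>x \<in> verts G. parity_law G c x)"

lemma all_less_3: "(\<forall>i<3. P i) \<longleftrightarrow> P 0 \<and> P 1 \<and> P (2::nat)"
proof -
  have "i < 3 \<longleftrightarrow> i = 0 \<or> i = 1 \<or> i = 2" for i :: nat by auto
  then show ?thesis by auto
qed

lemma even_sum_mult_iff:
  fixes f g :: "'e \<Rightarrow> int"
  assumes "finite E"
  shows "even (\<Sum>e\<in>E. f e * g e) \<longleftrightarrow> even (\<Sum>e\<in>{e \<in> E. odd (f e)}. g e)"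
proof -
  have "{e \<in> E. odd (f e * g e)} = {a \<in> {e \<in> E. odd (f e)}. odd (g a)}" by auto
  then show ?thesis using assms by (simp add: even_sum_iff)
qed

lemma count_mset_set_option: "count (mset_set (set_option a)) x = of_bool (a = Some x)"
  by (cases a) auto

definition incidence :: "('e \<Rightarrow> 'v option) \<Rightarrow> ('e \<Rightarrow> 'v option) \<Rightarrow> 'e \<Rightarrow> 'v \<Rightarrow> int" where
  "incidence tail head e x = of_bool (head e = Some x) - of_bool (tail e = Some x)"

lemma arc_vector_incidence: "arc_vector (incidence tail head e)"
  unfolding arc_vector_def incidence_def by blast

lemma net_inflow_eq_sum_incidence:
  fixes f :: "'e \<Rightarrow> int"
  assumes "finite E"
  shows "(\<Sum>e | e \<in> E \<and> head e = Some x. f e) - (\<Sum>e | e \<in> E \<and> tail e = Some x. f e) =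
    (\<Sum>e\<in>E. f e * incidence tail head e x)"
proof -
  have "(\<Sum>e | e \<in> E \<and> g e = Some x. f e) = (\<Sum>e\<in>E. f e * of_bool (g e = Some x))"
    for g
    using sum.inter_filter[OF assms, of f "\<lambda>e. g e = Some x"]
    by (simp add: of_bool_def if_distrib cong: if_cong)
  then show ?thesis by (simp add: incidence_def sum_subtractf algebra_simps)
qed

lemma orientation_exists:
  assumes "finite_graph G"
  shows "\<exists>tail head. orientation G tail head"
proof -
  have "\<exists>t h. ends G e = mset_set (set_option t) + mset_set (set_option h)"
    if "e \<in> edges G" for e
  proof -
    have "size (ends G e) \<le> 2" using assms that by (auto simp: finite_graph_def)
    then consider "size (ends G e) = 0" | "size (ends G e) = 1" | "size (ends G e) = 2"
      by linarith
    then show ?thesis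
    proof cases
      case 1
      then show ?thesis by (intro exI[of _ None]) auto
    next
      case 2
      then obtain x where "ends G e = {#x#}" using size_1_singleton_mset by blast
      then show ?thesis by (intro exI[of _ None] exI[of _ "Some x"]) auto
    next
      case 3
      then obtain x y where "ends G e = {#x, y#}"
        by (metis One_nat_def Suc_1 size_1_singleton_mset size_eq_Suc_imp_eq_union size_add_mset Suc_inject)
      then show ?thesis by (intro exI[of _ "Some x"] exI[of _ "Some y"]) auto
    qed
  qed
  then show ?thesis unfolding orientation_def by metis
qed

text \<open>Modulo 2 the sign of an incidence is invisible. A loop at \<open>x\<close> contributes 0
  on the left and 2 on the right, so only parities can be compared.\<close>

lemma even_sum_incidence_iff:
  assumes "orientation G tail head" "B \<subseteq> edges G" "finite B"
  shows "even (\<Sum>e\<in>B. incidence tail head e x) \<longleftrightarrow> even (\<Sum>e\<in>B. count (ends G e) x)"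
proof -
  have "odd (incidence tail head e x) \<longleftrightarrow> odd (count (ends G e) x)" if "e \<in> B" for e
  proof -
    have "count (ends G e) x = of_bool (tail e = Some x) + of_bool (head e = Some x)"
      using assms that by (auto simp: orientation_def count_mset_set_option)
    then show ?thesis by (auto simp: incidence_def)
  qed
  then have "{e \<in> B. odd (incidence tail head e x)} = {e \<in> B. odd (count (ends G e) x)}" by blast
  then show ?thesis using assms(3) by (simp add: even_sum_iff)
qed

text \<open>The splitting argument requires even sums at every element of the vertex type; this
  settles the elements that are not vertices of \<open>G\<close>.\<close>

lemma incidence_outside:
  assumes "finite_graph G" "orientation G tail head" "e \<in> edges G" "x \<notin> verts G"
  shows "incidence tail head e x = 0"
proof -
  have "x \<notin># ends G e" using assms by (auto simp: finite_graph_def)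
  then have "count (ends G e) x = 0" by (simp add: not_in_iff)
  then have "tail e \<noteq> Some x" "head e \<noteq> Some x"
    using assms by (auto simp: orientation_def count_mset_set_option)
  then show ?thesis by (simp add: incidence_def)
qed

lemma colour_degree_Un:
  assumes "finite (edges G)" "i \<noteq> j"
  shows "(\<Sum>e\<in>{e \<in> edges G. c e = i \<or> c e = j}. count (ends G e) x) =
    colour_degree G c i x + colour_degree G c j x"
proof -
  have "{e \<in> edges G. c e = i \<or> c e = j} = {e \<in> edges G. c e = i} \<union> {e \<in> edges G. c e = j}"
    by auto
  then show ?thesis unfolding colour_degree_def
    using assms by (subst sum.union_disjoint[symmetric]) auto
qed

text \<open>The flow is written as \<open>f = g + 2 * h\<close>, where \<open>g\<close> is a flow
  with values 1 and -1 on the odd edges and 0 elsewhere. Then \<open>h\<close> is an integer flow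
  too, and the parities of \<open>f\<close> and \<open>h\<close> are the two coordinates of a flow
  over the Klein four-group.\<close>

lemma flow_imp_parity_colouring:
  assumes fg: "finite_graph G" and "has_nowhere_zero_flow 4 G"
  shows "\<exists>c. parity_colouring G c"
proof -
  obtain tail head and f :: "'b \<Rightarrow> int" where
    ori: "orientation G tail head" and
    nz: "\<And>e. e \<in> edges G \<Longrightarrow> f e \<noteq> 0 \<and> \<bar>f e\<bar> < 4" and
    kir: "\<And>x. x \<in> verts G \<Longrightarrow> (\<Sum>e | e \<in> edges G \<and> head e = Some x. f e) =
       (\<Sum>e | e \<in> edges G \<and> tail e = Some x. f e)"
    using assms(2) unfolding has_nowhere_zero_flow_def of_nat_numeral by blast
  define d where "d = incidence tail head"
  have fin: "finite (edges G)" using fg by (simp add: finite_graph_def)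
  have bal: "(\<Sum>e\<in>edges G. f e * d e x) = 0" for x
  proof (cases "x \<in> verts G")
    case True
    then show ?thesis using net_inflow_eq_sum_incidence[OF fin, where head = head and tail = tail and f = f and x = x] kir[OF True]
      by (simp add: d_def)
  next
    case False
    then show ?thesis using incidence_outside[OF fg ori] by (simp add: d_def)
  qed
  \<comment> \<open>Kirchhoff's law modulo 2 says that the edges with odd value form an even
    subgraph, so they have an Eulerian orientation, given by the signs \<open>s\<close>.\<close>
  define B where "B = {e \<in> edges G. odd (f e)}"
  have evB: "even (\<Sum>e\<in>B. d e x)" for x
    using even_sum_mult_iff[OF fin, of f "\<lambda>e. d e x"] bal[of x] by (simp add: B_def)
  have finB: "finite B" using fin by (simp add: B_def)
  obtain s :: "'b \<Rightarrow> int" where s: "\<And>e. s e = 1 \<or> s e = -1" "\<And>x. (\<Sum>e\<in>B. s e * d e x) = 0"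
    using even_arcs_balanced_signs[OF finB, of d] evB arc_vector_incidence unfolding d_def by metis
  define g where "g = (\<lambda>e. if odd (f e) then s e else 0)"
  \<comment> \<open>The division is exact, because \<open>f\<close> and \<open>g\<close> have the
    same parity on every edge.\<close>
  define h where "h = (\<lambda>e. (f e - g e) div 2)"
  have h2: "2 * h e = f e - g e" for e
  proof -
    have "even (f e - g e)" using s(1)[of e] by (auto simp: g_def)
    then show ?thesis by (simp add: h_def)
  qed
  have "2 * (\<Sum>e\<in>edges G. h e * d e x) = 0" for x
  proof -
    have "(\<Sum>e\<in>edges G. g e * d e x) = (\<Sum>e\<in>B. s e * d e x)"
      unfolding B_def sum.inter_filter[OF fin] by (intro sum.cong) (auto simp: g_def)
    moreover have "2 * (\<Sum>e\<in>edges G. h e * d e x) =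
        (\<Sum>e\<in>edges G. f e * d e x) - (\<Sum>e\<in>edges G. g e * d e x)"
      unfolding sum_distrib_left sum_subtractf[symmetric]
      using h2 by (intro sum.cong refl) (metis left_diff_distrib mult.assoc)
    ultimately show ?thesis using s(2)[of x] bal[of x] by simp
  qed
  then have balh: "(\<Sum>e\<in>edges G. h e * d e x) = 0" for x by simp
  define A where "A = {e \<in> edges G. odd (h e)}"
  have evA: "even (\<Sum>e\<in>A. d e x)" for x
    using even_sum_mult_iff[OF fin, of h "\<lambda>e. d e x"] balh[of x] by (simp add: A_def)
  have sub: "A \<subseteq> edges G" "B \<subseteq> edges G" "finite A" using fin by (auto simp: A_def B_def)
  \<comment> \<open>No edge gets the zero pair: an edge with even \<open>f e\<close> has value 2 or
    -2, hence \<open>h e\<close> is 1 or -1.\<close>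
  have cover: "e \<in> A \<or> e \<in> B" if "e \<in> edges G" for e
  proof (cases "odd (f e)")
    case False
    then have "f e = 2 \<or> f e = -2" using nz[OF that] by presburger
    moreover have "2 * h e = f e" using h2[of e] False by (simp add: g_def)
    ultimately have "h e = 1 \<or> h e = -1" by auto
    then show ?thesis using that by (auto simp: A_def)
  qed (use that in \<open>auto simp: B_def\<close>)
  \<comment> \<open>Colour 0 stands for membership in \<open>A\<close> only, 1 for \<open>B\<close>
    only and 2 for both. Thus \<open>A\<close> consists of the colours 0 and 2, and \<open>B\<close>
    of the colours 1 and 2.\<close>
  define c :: "'b \<Rightarrow> nat" where "c = (\<lambda>e. if e \<in> A then (if e \<in> B then 2 else 0) else 1)"
  have "A = {e \<in> edges G. c e = 0 \<or> c e = 2}" "B = {e \<in> edges G. c e = 1 \<or> c e = 2}"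
    using sub cover by (auto simp: c_def)
  then have sums: "(\<Sum>e\<in>A. count (ends G e) x) = colour_degree G c 0 x + colour_degree G c 2 x"
    "(\<Sum>e\<in>B. count (ends G e) x) = colour_degree G c 1 x + colour_degree G c 2 x" for x
    using colour_degree_Un[OF fin, of 0 2 x c] colour_degree_Un[OF fin, of 1 2 x c] by simp_all
  have "even (\<Sum>e\<in>A. count (ends G e) x)" "even (\<Sum>e\<in>B. count (ends G e) x)" for x
    using evA[of x] evB[of x] even_sum_incidence_iff[OF ori] sub finB by (auto simp: d_def)
  then have "even (colour_degree G c 0 x + colour_degree G c 2 x)"
    "even (colour_degree G c 1 x + colour_degree G c 2 x)" for x
    unfolding sums .
  then have "parity_law G c x" for x
    unfolding parity_law_def all_less_3 by auto
  moreover have "c e < 3" for e by (auto simp: c_def)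
  ultimately show ?thesis unfolding parity_colouring_def by blast
qed

text \<open>Two colour classes together have even degree at every vertex, so they carry a flow with
  values 1 and -1. Two such flows \<open>s\<close> and \<open>t\<close>, on the colours 0, 2 and 1,
  2, are combined into \<open>2 * s + t\<close>.\<close>

lemma parity_colouring_imp_flow:
  assumes fg: "finite_graph G" and c: "parity_colouring G c"
  shows "has_nowhere_zero_flow 4 G"
proof -
  obtain tail head where ori: "orientation G tail head" using orientation_exists[OF fg] by blast
  define d where "d = incidence tail head"
  have fin: "finite (edges G)" using fg by (simp add: finite_graph_def)
  have sgn: "\<exists>s :: 'b \<Rightarrow> int. (\<forall>e. s e = 1 \<or> s e = -1) \<and>
      (\<forall>x. (\<Sum>e\<in>{e \<in> edges G. c e = i \<or> c e = j}. s e * d e x) = 0)"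
    if ij: "i < 3" "j < 3" "i \<noteq> j" for i j
  proof (rule even_arcs_balanced_signs)
    let ?A = "{e \<in> edges G. c e = i \<or> c e = j}"
    show "finite ?A" using fin by auto
    show "arc_vector (d e)" for e by (simp add: d_def arc_vector_incidence)
    show "even (\<Sum>e\<in>?A. d e x)" for x
    proof (cases "x \<in> verts G")
      case True
      then have "even (colour_degree G c i x) \<longleftrightarrow> even (colour_degree G c j x)"
        using c ij unfolding parity_colouring_def parity_law_def by blast
      then have "even (colour_degree G c i x + colour_degree G c j x)" by simp
      then show ?thesis unfolding d_def
        using ij fin by (subst even_sum_incidence_iff[OF ori]) (auto simp: colour_degree_Un)
    next
      case False
      then show ?thesis using incidence_outside[OF fg ori] by (simp add: d_def)
    qed
  qed
  have lt: "(0::nat) < 3" "(1::nat) < 3" "(2::nat) < 3" "(0::nat) \<noteq> 2" "(1::nat) \<noteq> 2" by auto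
  obtain s :: "'b \<Rightarrow> int" where s: "\<And>e. s e = 1 \<or> s e = -1"
    "\<And>x. (\<Sum>e\<in>{e \<in> edges G. c e = 0 \<or> c e = 2}. s e * d e x) = 0"
    using sgn[OF lt(1,3,4)] by blast
  obtain t :: "'b \<Rightarrow> int" where t: "\<And>e. t e = 1 \<or> t e = -1"
    "\<And>x. (\<Sum>e\<in>{e \<in> edges G. c e = 1 \<or> c e = 2}. t e * d e x) = 0"
    using sgn[OF lt(2,3,5)] by blast
  \<comment> \<open>The absolute value is 2 on colour 0, 1 on colour 1, and 1 or 3 on colour
    2.\<close>
  define f where "f = (\<lambda>e. 2 * (if c e = 0 \<or> c e = 2 then s e else 0) +
    (if c e = 1 \<or> c e = 2 then t e else 0))"
  have "(\<Sum>e\<in>edges G. f e * d e x) = 0" for x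
  proof -
    have "(\<Sum>e\<in>edges G. f e * d e x) =
      2 * (\<Sum>e\<in>edges G. if c e = 0 \<or> c e = 2 then s e * d e x else 0) +
      (\<Sum>e\<in>edges G. if c e = 1 \<or> c e = 2 then t e * d e x else 0)"
      unfolding sum_distrib_left sum.distrib[symmetric]
      by (intro sum.cong refl) (simp add: f_def distrib_right)
    then show ?thesis using s(2)[of x] t(2)[of x] by (simp add: sum.inter_filter[OF fin])
  qed
  then have "(\<Sum>e | e \<in> edges G \<and> head e = Some x. f e) =
       (\<Sum>e | e \<in> edges G \<and> tail e = Some x. f e)" for x
    using net_inflow_eq_sum_incidence[OF fin, where head = head and tail = tail and f = f and x = x] by (simp add: d_def)
  moreover have "f e \<noteq> 0 \<and> \<bar>f e\<bar> < 4" if "e \<in> edges G" for e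
  proof -
    have "c e < 3" using c that by (auto simp: parity_colouring_def)
    then have "c e = 0 \<or> c e = 1 \<or> c e = 2" by auto
    then show ?thesis using s(1)[of e] t(1)[of e] by (elim disjE) (simp_all add: f_def)
  qed
  ultimately show ?thesis using ori unfolding has_nowhere_zero_flow_def of_nat_numeral by blast
qed

lemma nowhere_zero_4_flow_iff_parity_colouring:
  assumes "finite_graph G"
  shows "has_nowhere_zero_flow 4 G \<longleftrightarrow> (\<exists>c. parity_colouring G c)"
  using flow_imp_parity_colouring parity_colouring_imp_flow assms by blast

section \<open>Parity law at vertices of degree two and three, and proper colourings\<close>

lemma colour_degree_cong:
  assumes "\<And>e. e \<in> edges G \<Longrightarrow> c e = c' e"
  shows "colour_degree G c i x = colour_degree G c' i x"
  unfolding colour_degree_def using assms by (intro sum.cong) auto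

lemma sum_colour_degree:
  assumes "finite (edges G)" "\<forall>e \<in> edges G. c e < 3"
  shows "colour_degree G c 0 x + colour_degree G c 1 x + colour_degree G c 2 x = degree G x"
proof -
  have "degree G x = (\<Sum>i\<in>{..<3}. colour_degree G c i x)"
    unfolding degree_def colour_degree_def
    using assms by (intro sum.group[symmetric]) auto
  then show ?thesis by (simp add: eval_nat_numeral)
qed

lemma sum_count_le_colour_degree:
  assumes "finite (edges G)" "F \<subseteq> edges G" "\<And>a. a \<in> F \<Longrightarrow> c a = i"
  shows "(\<Sum>a\<in>F. count (ends G a) x) \<le> colour_degree G c i x"
  unfolding colour_degree_def using assms by (intro sum_mono2) auto

lemma sum_count_le_degree:
  assumes "finite (edges G)" "F \<subseteq> edges G"
  shows "(\<Sum>a\<in>F. count (ends G a) x) \<le> degree G x"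
  unfolding degree_def using assms by (intro sum_mono2) auto

text \<open>Three numbers of equal parity share the parity of their sum. Here all are odd, hence at
  least 1, and the total leaves no room for more.\<close>

lemma sum_3_equal_parity:
  fixes a b c :: nat
  assumes "a + b + c = 3" "even a \<longleftrightarrow> even b" "even a \<longleftrightarrow> even c"
  shows "a = 1" "b = 1" "c = 1"
  using assms by presburger+

lemma sum_2_equal_parity:
  fixes a b c :: nat
  assumes "a + b + c = 2" "even a \<longleftrightarrow> even b" "even a \<longleftrightarrow> even c"
  shows "even a" "even b" "even c"
  using assms by presburger+

lemma parity_law_degree_3:
  assumes "finite (edges G)" "\<forall>e \<in> edges G. c e < 3" "parity_law G c x" "degree G x = 3" "i < 3"
  shows "colour_degree G c i x = 1"
proof -
  have "colour_degree G c 0 x = 1 \<and> colour_degree G c 1 x = 1 \<and> colour_degree G c 2 x = 1"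
    using sum_3_equal_parity sum_colour_degree[OF assms(1,2), of x] assms(3,4)
    unfolding parity_law_def all_less_3 by metis
  then have "\<forall>i<3. colour_degree G c i x = 1" unfolding all_less_3 .
  then show ?thesis using assms(5) by blast
qed

lemma parity_law_degree_2:
  assumes "finite (edges G)" "\<forall>e \<in> edges G. c e < 3" "parity_law G c x" "degree G x = 2" "i < 3"
  shows "even (colour_degree G c i x)"
proof -
  have "even (colour_degree G c 0 x) \<and> even (colour_degree G c 1 x) \<and> even (colour_degree G c 2 x)"
    using sum_2_equal_parity sum_colour_degree[OF assms(1,2), of x] assms(3,4)
    unfolding parity_law_def all_less_3 by metis
  then have "\<forall>i<3. even (colour_degree G c i x)" unfolding all_less_3 .
  then show ?thesis using assms(5) by blast
qed

lemma loop_if_count_ge_2: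
  assumes "size M \<le> 2" "count M x \<ge> 2"
  shows "M = {#x, x#}"
proof -
  have "replicate_mset 2 x \<subseteq># M" using assms(2) by (simp add: count_le_replicate_mset_subset_eq)
  then have "{#x, x#} \<subseteq># M" by (simp add: numeral_2_eq_2)
  then obtain N where N: "M = {#x, x#} + N" by (metis subset_mset.le_iff_add)
  then have "size N = 0" using assms(1) by simp
  then show ?thesis using N by simp
qed

lemma sum_le_1:
  fixes f :: "'a \<Rightarrow> nat"
  assumes "finite F" "\<And>a. a \<in> F \<Longrightarrow> f a \<le> 1" "\<And>a b. a \<in> F \<Longrightarrow> b \<in> F \<Longrightarrow> a \<noteq> b \<Longrightarrow> f a = 0 \<or> f b = 0"
  shows "sum f F \<le> 1"
proof (cases "\<exists>a\<in>F. f a \<noteq> 0")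
  case True
  then obtain a where a: "a \<in> F" "f a \<noteq> 0" by blast
  then have "sum f (F - {a}) = 0" using assms(3)[of a] by (intro sum.neutral ballI) fastforce
  then show ?thesis using a assms(1,2) by (simp add: sum.remove[of F a])
qed auto

text \<open>Two edge-ends of one colour at \<open>x\<close> belong either to two adjacent edges or
  to a loop, and both are excluded by \<open>proper\<close>.\<close>

lemma colour_degree_proper_le_1:
  assumes fg: "finite_graph G"
    and proper: "\<And>a b. a \<in> edges G \<Longrightarrow> b \<in> edges G \<Longrightarrow> adjacent_edges G a b \<Longrightarrow> c a \<noteq> c b"
  shows "colour_degree G c i x \<le> 1"
  unfolding colour_degree_def
proof (rule sum_le_1)
  show "finite {e \<in> edges G. c e = i}" using fg by (simp add: finite_graph_def)
  show "count (ends G a) x \<le> 1" if "a \<in> {e \<in> edges G. c e = i}" for a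
  proof (rule ccontr)
    assume "\<not> count (ends G a) x \<le> 1"
    moreover have "size (ends G a) \<le> 2" using fg that by (auto simp: finite_graph_def)
    ultimately have "ends G a = {#x, x#}" by (intro loop_if_count_ge_2) auto
    then show False using proper[of a a] that by (auto simp: adjacent_edges_def)
  qed
  show "count (ends G a) x = 0 \<or> count (ends G b) x = 0"
    if "a \<in> {e \<in> edges G. c e = i}" "b \<in> {e \<in> edges G. c e = i}" "a \<noteq> b" for a b
    using proper[of a b] that unfolding adjacent_edges_def count_eq_zero_iff by auto
qed

text \<open>Both sides say that each of the three colours occurs on exactly one of the three
  edge-ends at every vertex. Dangling edges are allowed, so this also applies after vertices have
  been removed.\<close>

lemma edge_colourable_iff_parity_colouring:
  assumes fg: "finite_graph G" and deg: "cubic G"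
  shows "edge_colourable 3 G \<longleftrightarrow> (\<exists>c. parity_colouring G c)"
proof
  have fin: "finite (edges G)" using fg by (simp add: finite_graph_def)
  {
    assume "edge_colourable 3 G"
    then obtain c :: "'b \<Rightarrow> nat" where c3: "\<forall>e \<in> edges G. c e < 3"
      and proper: "\<And>a b. a \<in> edges G \<Longrightarrow> b \<in> edges G \<Longrightarrow> adjacent_edges G a b \<Longrightarrow> c a \<noteq> c b"
      unfolding edge_colourable_def by blast
    have "parity_law G c x" if "x \<in> verts G" for x
    proof -
      have "colour_degree G c i x \<le> 1" for i using colour_degree_proper_le_1[OF fg, of c] proper by blast
      from this[of 0] this[of 1] this[of 2]
      have "colour_degree G c 0 x = 1 \<and> colour_degree G c 1 x = 1 \<and> colour_degree G c 2 x = 1"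
        using sum_colour_degree[OF fin c3, of x] deg that by (simp add: cubic_def)
      then show ?thesis unfolding parity_law_def all_less_3 by simp
    qed
    then show "\<exists>c. parity_colouring G c" using c3 unfolding parity_colouring_def by blast
  next
    assume "\<exists>c. parity_colouring G c"
    then obtain c :: "'b \<Rightarrow> nat" where c3: "\<forall>e \<in> edges G. c e < 3"
      and par: "\<And>x. x \<in> verts G \<Longrightarrow> parity_law G c x"
      unfolding parity_colouring_def by blast
    have one: "colour_degree G c i x = 1" if "x \<in> verts G" "i < 3" for i x
      using parity_law_degree_3[OF fin c3 par[OF that(1)]] that deg by (auto simp: cubic_def)
    have "c a \<noteq> c b" if ab: "a \<in> edges G" "b \<in> edges G" "adjacent_edges G a b" for a b
    proof
      assume eq: "c a = c b"
      obtain x where x: "x \<in># ends G a" "a \<noteq> b \<and> x \<in># ends G b \<or> a = b \<and> ends G a = {#x, x#}"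
        using ab(3) unfolding adjacent_edges_def by auto
      have xV: "x \<in> verts G" using x ab fg by (auto simp: finite_graph_def)
      \<comment> \<open>Two edges of the same colour at \<open>x\<close> give two edge-ends of that
        colour. If \<open>a = b\<close>, the set collapses to one edge, but it is a loop and counts
        twice.\<close>
      have "(\<Sum>e\<in>{a, b}. count (ends G e) x) \<ge> 2"
      proof (cases "a = b")
        case False
        then have "Suc 0 \<le> count (ends G a) x" "Suc 0 \<le> count (ends G b) x"
          using x by (auto simp: Suc_le_eq)
        then have "2 \<le> count (ends G a) x + count (ends G b) x" by linarith
        then show ?thesis using False by simp
      qed (use x in auto)
      moreover have "(\<Sum>e\<in>{a, b}. count (ends G e) x) \<le> colour_degree G c (c a) x"
        using ab eq by (intro sum_count_le_colour_degree fin) auto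
      ultimately show False using one[OF xV] c3 ab(1) by fastforce
    qed
    then show "edge_colourable 3 G" using c3 unfolding edge_colourable_def by blast
  }
qed

section \<open>Handshaking, identification and removal of vertices\<close>

lemma sum_count_eq_size:
  assumes "finite V" "set_mset M \<subseteq> V"
  shows "(\<Sum>x\<in>V. count M x) = size M"
  unfolding size_multiset_overloaded_eq
  using assms by (intro sum.mono_neutral_right) (auto simp: count_eq_zero_iff)

text \<open>Double counting: in the absence of dangling edges, every edge of the colour class
  contributes 2.\<close>

lemma handshake:
  assumes fg: "finite_graph G" and nd: "no_dangling_edges G"
  shows "even (\<Sum>x\<in>verts G. colour_degree G c i x)"
proof -
  have "(\<Sum>x\<in>verts G. colour_degree G c i x) =
      (\<Sum>e\<in>{e \<in> edges G. c e = i}. \<Sum>x\<in>verts G. count (ends G e) x)"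
    unfolding colour_degree_def by (rule sum.swap)
  also have "\<dots> = (\<Sum>e\<in>{e \<in> edges G. c e = i}. 2)"
    using fg nd by (intro sum.cong refl) (simp add: sum_count_eq_size finite_graph_def no_dangling_edges_def)
  finally show ?thesis by simp
qed

text \<open>The common form of the statements (i) to (iii): Kirchhoff's law is waived on
  \<open>S\<close> instead of changing the graph.\<close>

definition parity_colouring_off :: "('v, 'e) multigraph \<Rightarrow> 'v set \<Rightarrow> ('e \<Rightarrow> nat) \<Rightarrow> bool" where
  "parity_colouring_off G S c \<longleftrightarrow>
     (\<forall>e \<in> edges G. c e < 3) \<and> (\<forall>x \<in> verts G - S. parity_law G c x)"

text \<open>Over all vertices each colour has an even total. Outside \<open>S\<close> the colours
  agree in parity vertex by vertex, so what remains over \<open>S\<close> agrees as well.\<close>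

lemma parity_colouring_off_sum:
  assumes fg: "finite_graph G" and nd: "no_dangling_edges G" and S: "S \<subseteq> verts G"
    and c: "parity_colouring_off G S c" and ij: "i < 3" "j < 3"
  shows "even (\<Sum>x\<in>S. colour_degree G c i x) \<longleftrightarrow> even (\<Sum>x\<in>S. colour_degree G c j x)"
proof -
  have fV: "finite (verts G)" using fg by (simp add: finite_graph_def)
  have split: "(\<Sum>x\<in>verts G. colour_degree G c k x) =
      (\<Sum>x\<in>verts G - S. colour_degree G c k x) + (\<Sum>x\<in>S. colour_degree G c k x)" for k
    using sum.subset_diff[OF S fV] .
  have "{x \<in> verts G - S. odd (colour_degree G c i x)} = {x \<in> verts G - S. odd (colour_degree G c j x)}"
    using c ij unfolding parity_colouring_off_def parity_law_def by blast
  then have "even (\<Sum>x\<in>verts G - S. colour_degree G c i x) \<longleftrightarrow>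
      even (\<Sum>x\<in>verts G - S. colour_degree G c j x)"
    using fV by (simp add: even_sum_iff)
  then show ?thesis
    using handshake[OF fg nd, of c i] handshake[OF fg nd, of c j] unfolding split by simp
qed

lemma finite_graph_identify:
  assumes "finite_graph G"
  shows "finite_graph (identify_vertices G S)"
  using assms unfolding finite_graph_def identify_vertices_def Let_def by auto

text \<open>The new vertex collects the edge-ends of all of \<open>S\<close>, so the law there is
  the global parity statement just proved. All other vertices keep their edge-ends.\<close>

lemma parity_colouring_identify_iff:
  assumes fg: "finite_graph G" and nd: "no_dangling_edges G" and S: "S \<subseteq> verts G" "S \<noteq> {}"
  shows "parity_colouring (identify_vertices G S) c \<longleftrightarrow> parity_colouring_off G S c"
proof -
  define s where "s = (SOME s. s \<in> S)"
  have sS: "s \<in> S" using S unfolding s_def by (simp add: some_in_eq)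
  define r where "r = (\<lambda>x. if x \<in> S then s else x)"
  let ?H = "identify_vertices G S"
  have H: "verts ?H = r ` verts G" "edges ?H = edges G" "\<And>e. ends ?H e = image_mset r (ends G e)"
    unfolding identify_vertices_def Let_def r_def s_def by auto
  have vH: "verts ?H = insert s (verts G - S)"
    unfolding H using S sS by (auto simp: r_def)
  have finS: "finite S" using finite_subset[OF S(1)] fg by (simp add: finite_graph_def)
  have off: "colour_degree ?H c i x = colour_degree G c i x" if "x \<notin> S" for i x
  proof -
    have "count (image_mset r M) x = count M x" for M
    proof -
      have "r -` {x} \<inter> set_mset M = (if x \<in># M then {x} else {})"
        using that sS by (auto simp: r_def split: if_splits)
      then show ?thesis by (auto simp: count_image_mset count_eq_zero_iff)
    qed
    then show ?thesis by (simp add: colour_degree_def H)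
  qed
  have at: "colour_degree ?H c i s = (\<Sum>x\<in>S. colour_degree G c i x)" for i
  proof -
    have "count (image_mset r M) s = (\<Sum>x\<in>S. count M x)" for M
    proof -
      have "r -` {s} \<inter> set_mset M = S \<inter> set_mset M"
        using sS by (auto simp: r_def split: if_splits)
      then show ?thesis unfolding count_image_mset
        using finS by (intro sum.mono_neutral_cong_left) (auto simp: count_eq_zero_iff)
    qed
    then show ?thesis unfolding colour_degree_def H by (subst sum.swap) simp
  qed
  have law: "parity_law ?H c x \<longleftrightarrow> parity_law G c x" if "x \<notin> S" for x
    using off[OF that] by (simp add: parity_law_def)
  show ?thesis
  proof
    assume "parity_colouring ?H c"
    then show "parity_colouring_off G S c"
      unfolding parity_colouring_def parity_colouring_off_def using law by (auto simp: vH H(2))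
  next
    assume c: "parity_colouring_off G S c"
    then have "parity_law ?H c s"
      using parity_colouring_off_sum[OF fg nd S(1) c] unfolding parity_law_def at by blast
    then show "parity_colouring ?H c"
      using c unfolding parity_colouring_def parity_colouring_off_def using law by (auto simp: vH H(2))
  qed
qed

lemma finite_graph_remove:
  assumes "finite_graph G"
  shows "finite_graph (remove_vertices G S)"
  using assms unfolding finite_graph_def remove_vertices_def
  by (auto intro: le_trans[OF size_filter_mset_lesseq])

lemma colour_degree_remove:
  assumes "finite (edges G)" "x \<notin> S"
  shows "colour_degree (remove_vertices G S) c i x = colour_degree G c i x"
  unfolding colour_degree_def remove_vertices_def
  using assms by (auto intro!: sum.mono_neutral_cong_left simp: count_eq_zero_iff)

lemma degree_remove:
  assumes "finite (edges G)" "x \<notin> S"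
  shows "degree (remove_vertices G S) x = degree G x"
  unfolding degree_def remove_vertices_def
  using assms by (auto intro!: sum.mono_neutral_cong_left simp: count_eq_zero_iff)

lemma parity_colouring_remove_iff:
  assumes fg: "finite_graph G"
  shows "(\<exists>c. parity_colouring (remove_vertices G S) c) \<longleftrightarrow> (\<exists>c. parity_colouring_off G S c)"
proof
  let ?H = "remove_vertices G S"
  have fin: "finite (edges G)" using fg by (simp add: finite_graph_def)
  have V: "verts ?H = verts G - S" and E: "edges ?H \<subseteq> edges G" by (auto simp: remove_vertices_def)
  have law: "parity_law ?H c x \<longleftrightarrow> parity_law G c x" if "x \<notin> S" for c x
    using colour_degree_remove[OF fin that, of c] by (simp add: parity_law_def)
  {
    assume "\<exists>c. parity_colouring ?H c"
    then obtain c where c: "parity_colouring ?H c" by blast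
    \<comment> \<open>The edges that disappear have no end outside \<open>S\<close>; any colour will
      do for them, and 0 is chosen.\<close>
    define c' where "c' = (\<lambda>e. if e \<in> edges ?H then c e else 0)"
    have "colour_degree ?H c' i x = colour_degree ?H c i x" for i x
      by (rule colour_degree_cong) (simp add: c'_def)
    then have "parity_law ?H c' x \<longleftrightarrow> parity_law ?H c x" for x by (simp add: parity_law_def)
    then have "parity_law G c' x" if "x \<in> verts G - S" for x
      using c that V law[of x c'] unfolding parity_colouring_def by blast
    moreover have "c' e < 3" for e using c by (auto simp: c'_def parity_colouring_def)
    ultimately show "\<exists>c. parity_colouring_off G S c" unfolding parity_colouring_off_def by blast
  next
    assume "\<exists>c. parity_colouring_off G S c"
    then show "\<exists>c. parity_colouring ?H c"
      unfolding parity_colouring_off_def parity_colouring_def V using law E by blast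
  }
qed

section \<open>Deletion of an edge of a snark\<close>

lemma delete_edge_sel [simp]:
  "verts (delete_edge G e) = verts G" "edges (delete_edge G e) = edges G - {e}"
  "ends (delete_edge G e) = ends G"
  by (simp_all add: delete_edge_def)

lemma degree_delete_edge:
  assumes "finite (edges G)" "e \<in> edges G"
  shows "degree G x = degree (delete_edge G e) x + count (ends G e) x"
  using assms by (simp add: degree_def sum.remove)

lemma colour_degree_extend:
  assumes "finite (edges G)" "e \<in> edges G"
  shows "colour_degree G (c(e := k)) i x =
    colour_degree (delete_edge G e) c i x + (if i = k then count (ends G e) x else 0)"
proof -
  have "{a \<in> edges G. (c(e := k)) a = i} =
      (if i = k then insert e {a \<in> edges G - {e}. c a = i} else {a \<in> edges G - {e}. c a = i})"
    using assms by auto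
  then show ?thesis using assms by (simp add: colour_degree_def)
qed

text \<open>The uncolourability of \<open>G\<close> enters here: a failure of the law at an end of
  \<open>e\<close> would let the colouring extend to \<open>G\<close>.\<close>

lemma snark_off_ends_imp_parity_colouring_delete:
  fixes G :: "('v, 'e) multigraph"
  assumes G: "snark G" and e: "e \<in> edges G" "ends G e = {#u, v#}" and uv: "u \<noteq> v"
    and c: "parity_colouring_off (delete_edge G e) {u, v} c"
  shows "parity_colouring (delete_edge G e) c"
proof (rule ccontr)
  let ?D = "delete_edge G e"
  assume no: "\<not> parity_colouring ?D c"
  have fg: "finite_graph G" and nd: "no_dangling_edges G" and cub: "cubic G"
    and nc: "\<not> edge_colourable 3 G" using G by (auto simp: snark_def)
  have fin: "finite (edges G)" using fg by (simp add: finite_graph_def)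
  have fgD: "finite_graph ?D" and ndD: "no_dangling_edges ?D"
    using fg nd by (auto simp: finite_graph_def no_dangling_edges_def)
  have uvV: "u \<in> verts G" "v \<in> verts G" using fg e by (auto simp: finite_graph_def)
  have deg: "degree ?D u = 2" "degree ?D v = 2"
    using degree_delete_edge[OF fin e(1), of u] degree_delete_edge[OF fin e(1), of v] cub uvV uv e(2)
    by (auto simp: cubic_def)
  have c3: "\<forall>a\<in>edges ?D. c a < 3" using c by (simp add: parity_colouring_off_def)
  define n where "n = (\<lambda>i x. colour_degree ?D c i x)"
  have tot: "n 0 u + n 1 u + n 2 u = 2" "n 0 v + n 1 v + n 2 v = 2"
    using sum_colour_degree[OF _ c3, of u] sum_colour_degree[OF _ c3, of v] fin deg
    by (auto simp: n_def)
  have eq: "even (n i u + n i v) \<longleftrightarrow> even (n j u + n j v)" if "i < 3" "j < 3" for i j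
    using parity_colouring_off_sum[OF fgD ndD _ c that] uvV uv by (simp add: n_def)
  \<comment> \<open>The sums \<open>n i u + n i v\<close> have one common parity for all
    \<open>i\<close>, and their total is 4, so each of them is even.\<close>
  have par: "even (n 0 u) \<longleftrightarrow> even (n 0 v)" "even (n 1 u) \<longleftrightarrow> even (n 1 v)"
    "even (n 2 u) \<longleftrightarrow> even (n 2 v)"
    using eq[of 0 1] eq[of 0 2] tot by presburger+
  have "\<not> (even (n 0 u) \<and> even (n 1 u) \<and> even (n 2 u))"
  proof
    assume "even (n 0 u) \<and> even (n 1 u) \<and> even (n 2 u)"
    then have "\<forall>i<3. even (n i u) \<and> even (n i v)" using par unfolding all_less_3 by blast
    then have "parity_law ?D c u" "parity_law ?D c v" unfolding parity_law_def n_def by blast+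
    then show False using no c unfolding parity_colouring_def parity_colouring_off_def by blast
  qed
  \<comment> \<open>An even total with some odd summand leaves exactly two odd ones;
    \<open>k\<close> is the colour absent at \<open>u\<close>, and by \<open>par\<close> also at
    \<open>v\<close>.\<close>
  moreover have "even (n 0 u + n 1 u + n 2 u)" using tot(1) by simp
  ultimately consider "even (n 0 u)" "odd (n 1 u)" "odd (n 2 u)" | "odd (n 0 u)" "even (n 1 u)" "odd (n 2 u)"
    | "odd (n 0 u)" "odd (n 1 u)" "even (n 2 u)"
    unfolding even_add by blast
  then obtain k where k: "k < 3" "\<forall>i<3. even (n i u) \<longleftrightarrow> i = k"
    unfolding all_less_3
  proof cases
    case 1 then show ?thesis using that[of 0] unfolding all_less_3 by simp
  next
    case 2 then show ?thesis using that[of 1] unfolding all_less_3 by simp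
  next
    case 3 then show ?thesis using that[of 2] unfolding all_less_3 by simp
  qed
  have kv: "\<forall>i<3. even (n i v) \<longleftrightarrow> i = k" using k(2) par unfolding all_less_3 by blast
  have cd: "colour_degree G (c(e := k)) i x = n i x + (if i = k then count (ends G e) x else 0)" for i x
    unfolding n_def by (rule colour_degree_extend[OF fin e(1)])
  have "parity_law G (c(e := k)) x" if "x \<in> verts G" for x
  proof (cases "x = u \<or> x = v")
    case True
    \<comment> \<open>The edge \<open>e\<close> adds one edge-end of colour \<open>k\<close> at each
      of its ends, which makes all three colour degrees odd there.\<close>
    then have "odd (colour_degree G (c(e := k)) i x)" if "i < 3" for i
      using k(2) kv that uv e(2) unfolding cd by auto
    then show ?thesis unfolding parity_law_def by blast
  next
    case False
    then have "count (ends G e) x = 0" using e(2) by auto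
    then have "colour_degree G (c(e := k)) i x = colour_degree ?D c i x" for i
      unfolding cd by (simp add: n_def)
    then have "parity_law G (c(e := k)) x \<longleftrightarrow> parity_law ?D c x" by (simp add: parity_law_def)
    moreover have "parity_law ?D c x" using c that False by (auto simp: parity_colouring_off_def)
    ultimately show ?thesis by blast
  qed
  moreover have "\<forall>a\<in>edges G. (c(e := k)) a < 3" using c3 k(1) by auto
  ultimately have "parity_colouring G (c(e := k))" unfolding parity_colouring_def by blast
  then show False using edge_colourable_iff_parity_colouring[OF fg cub] nc by blast
qed

section \<open>Suppression of vertices of degree two\<close>

definition meets :: "('v, 'e) multigraph \<Rightarrow> 'v set \<Rightarrow> ('e \<times> 'e) set" where
  "meets G W = {(a, b). a \<in> edges G \<and> b \<in> edges G \<and> (\<exists>w \<in> W. w \<in># ends G a \<and> w \<in># ends G b)}"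

lemma suppress_vertices_sel:
  "verts (suppress_vertices G W) = verts G - W"
  "edges (suppress_vertices G W) = edges G // (meets G W)\<^sup>*"
  "ends (suppress_vertices G W) C = (\<Sum>a\<in>C. filter_mset (\<lambda>x. x \<notin> W) (ends G a))"
  by (simp_all add: suppress_vertices_def meets_def)

lemma sym_meets: "sym (meets G W)"
  by (auto simp: sym_def meets_def)

text \<open>The reflexive closure also relates elements that are not edges to themselves, which is
  why the carrier is \<open>UNIV\<close>.\<close>

lemma equiv_meets: "equiv UNIV ((meets G W)\<^sup>*)"
  using sym_meets by (intro equivI refl_rtrancl sym_rtrancl trans_rtrancl) auto

lemma meets_class_subset:
  assumes "a \<in> edges G"
  shows "(meets G W)\<^sup>* `` {a} \<subseteq> edges G"
proof
  fix b assume "b \<in> (meets G W)\<^sup>* `` {a}"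
  then have "(a, b) \<in> (meets G W)\<^sup>*" by simp
  then show "b \<in> edges G" by induction (use assms in \<open>auto simp: meets_def\<close>)
qed

text \<open>At a vertex of degree two the parity law makes both edge-ends equal in colour. The
  colour is therefore constant along each suppressed path and passes to the merged edge.\<close>

lemma parity_colouring_imp_suppress_colourable:
  fixes G :: "('v, 'e) multigraph"
  assumes fg: "finite_graph G" and c: "parity_colouring G c"
    and W: "\<And>w. w \<in> W \<Longrightarrow> w \<in> verts G \<and> degree G w = 2"
    and deg: "\<And>x. x \<in> verts G - W \<Longrightarrow> degree G x = 3"
  shows "edge_colourable 3 (suppress_vertices G W)"
proof -
  let ?R = "(meets G W)\<^sup>*" and ?Q = "suppress_vertices G W"
  have fin: "finite (edges G)" using fg by (simp add: finite_graph_def)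
  have c3: "\<forall>e\<in>edges G. c e < 3" and law: "\<And>x. x \<in> verts G \<Longrightarrow> parity_law G c x"
    using c by (auto simp: parity_colouring_def)
  have step: "c a = c b" if m: "(a, b) \<in> meets G W" for a b
  proof (rule ccontr)
    assume ne: "c a \<noteq> c b"
    obtain w where ab: "a \<in> edges G" "b \<in> edges G" and w: "w \<in> W" "w \<in># ends G a" "w \<in># ends G b"
      using m by (auto simp: meets_def)
    \<comment> \<open>A colour present at \<open>w\<close> occurs there an even, positive number of
      times; two different colours would need four edge-ends at a vertex of degree two.\<close>
    have ge: "colour_degree G c (c p) w \<ge> 2" if p: "p \<in> edges G" "w \<in># ends G p" for p
    proof -
      have ev: "even (colour_degree G c (c p) w)"
        using parity_law_degree_2[OF fin c3, of w "c p"] W[OF w(1)] law c3 p by auto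
      have "count (ends G p) w \<le> colour_degree G c (c p) w"
        using sum_count_le_colour_degree[OF fin, of "{p}" c "c p" w] p by simp
      moreover have "count (ends G p) w > 0" using p by simp
      ultimately have "0 < colour_degree G c (c p) w" by linarith
      then show ?thesis by (rule dvd_imp_le[OF ev])
    qed
    have "colour_degree G c (c a) w + colour_degree G c (c b) w \<le> degree G w"
      using colour_degree_Un[OF fin ne, of w c]
        sum_count_le_degree[OF fin, of "{e \<in> edges G. c e = c a \<or> c e = c b}" w] by simp
    then show False using ge[OF ab(1) w(2)] ge[OF ab(2) w(3)] W[OF w(1)] by linarith
  qed
  have mono: "c a = c b" if "(a, b) \<in> ?R" for a b
    using that by induction (auto dest: step)
  \<comment> \<open>The choice of the member is immaterial, since \<open>c\<close> is constant on
    classes.\<close>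
  define k where "k = (\<lambda>C. c (SOME a. a \<in> C))"
  have k: "k C = c a" if C: "C \<in> edges ?Q" and a: "a \<in> C" for C a
  proof -
    have some: "(SOME a. a \<in> C) \<in> C" using a by (rule someI)
    have Q: "C \<in> UNIV // ?R" using C by (auto simp: suppress_vertices_sel quotient_def)
    have "((SOME a. a \<in> C), a) \<in> ?R"
      using quotient_eq_iff[OF equiv_meets Q Q some a] by simp
    then show ?thesis unfolding k_def by (rule mono)
  qed
  have sub: "C \<subseteq> edges G" if "C \<in> edges ?Q" for C
    using that meets_class_subset[of _ G W] unfolding suppress_vertices_sel quotient_def by blast
  have memb: "\<exists>a\<in>C. x \<in># ends G a \<and> x \<in> verts G - W"
    if C: "C \<in> edges ?Q" "x \<in># ends ?Q C" for C x
  proof -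
    have finC: "finite C" using sub[OF C(1)] fin finite_subset by blast
    obtain a where "a \<in> C" "x \<in># ends G a" "x \<notin> W"
      using C(2) finC by (auto simp: suppress_vertices_sel set_mset_sum)
    then show ?thesis using fg sub[OF C(1)] by (auto simp: finite_graph_def)
  qed
  have one: "colour_degree G c i x = 1" if "x \<in> verts G - W" "i < 3" for i x
    using parity_law_degree_3[OF fin c3] law deg that by auto
  have "k C \<noteq> k C'" if C: "C \<in> edges ?Q" "C' \<in> edges ?Q" and adj: "adjacent_edges ?Q C C'" for C C'
  proof (cases "C = C'")
    case False
    then obtain x where x: "x \<in># ends ?Q C" "x \<in># ends ?Q C'"
      using adj by (auto simp: adjacent_edges_def)
    obtain a where a: "a \<in> C" "x \<in># ends G a" "x \<in> verts G - W" using memb[OF C(1) x(1)] by blast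
    obtain b where b: "b \<in> C'" "x \<in># ends G b" using memb[OF C(2) x(2)] by blast
    \<comment> \<open>Different classes are disjoint, so the edges \<open>a\<close> and
      \<open>b\<close> that reach \<open>x\<close> are different edges of \<open>G\<close>.\<close>
    have "C \<in> UNIV // ?R" "C' \<in> UNIV // ?R"
      using C by (auto simp: suppress_vertices_sel quotient_def)
    then have "C \<inter> C' = {}" using quotient_disj[OF equiv_meets] False by blast
    then have ne: "a \<noteq> b" using a b by auto
    have ab: "a \<in> edges G" "b \<in> edges G" using sub C a b by auto
    have "c a \<noteq> c b"
    proof
      assume eq: "c a = c b"
      have "count (ends G a) x > 0" "count (ends G b) x > 0" using a b by auto
      moreover have "(\<Sum>e\<in>{a, b}. count (ends G e) x) \<le> colour_degree G c (c a) x"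
        using ab eq by (intro sum_count_le_colour_degree fin) auto
      moreover have "colour_degree G c (c a) x = 1" using one[OF a(3)] c3 ab(1) by blast
      moreover have "(\<Sum>e\<in>{a, b}. count (ends G e) x) = count (ends G a) x + count (ends G b) x"
        using ne by simp
      ultimately show False by linarith
    qed
    then show ?thesis using k[OF C(1) a(1)] k[OF C(2) b(1)] by simp
  next
    case True
    then obtain x where x: "ends ?Q C = {#x, x#}" using adj by (auto simp: adjacent_edges_def)
    then obtain a where a: "a \<in> C" "x \<in> verts G - W" using memb[OF C(1), of x] by auto
    \<comment> \<open>A merged loop at \<open>x\<close> would put two edge-ends of one colour at a
      vertex of degree three. The resulting \<open>2 \<le> 1\<close> is absurd.\<close>
    have "2 = count (ends ?Q C) x" using x by simp
    also have "\<dots> = (\<Sum>a\<in>C. count (ends G a) x)"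
      using a by (simp add: suppress_vertices_sel count_sum)
    also have "\<dots> \<le> colour_degree G c (k C) x"
      using sub[OF C(1)] k[OF C(1)] by (intro sum_count_le_colour_degree fin) simp_all
    also have "\<dots> = 1"
    proof (rule one[OF a(2)])
      show "k C < 3" using k[OF C(1) a(1)] c3 sub[OF C(1)] a(1) by auto
    qed
    finally show ?thesis by simp
  qed
  moreover have "k C < 3" if C: "C \<in> edges ?Q" for C
  proof -
    obtain a where "a \<in> edges G" "a \<in> C"
      using C by (auto simp: suppress_vertices_sel elim!: quotientE)
    then show ?thesis using k[OF C, of a] c3 by simp
  qed
  ultimately show ?thesis unfolding edge_colourable_def by blast
qed

lemma edges_at_degree_2:
  assumes "finite (edges G)" "degree G w = 2" "a \<in> edges G" "b \<in> edges G" "a \<noteq> b"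
    "w \<in># ends G a" "w \<in># ends G b" "d \<in> edges G" "w \<in># ends G d"
  shows "d = a \<or> d = b"
proof (rule ccontr)
  assume "\<not> (d = a \<or> d = b)"
  then have "(\<Sum>e\<in>{a, b, d}. count (ends G e) w) = count (ends G a) w + count (ends G b) w + count (ends G d) w"
    using assms(5) by auto
  moreover have "(\<Sum>e\<in>{a, b, d}. count (ends G e) w) \<le> 2"
    using sum_count_le_degree[OF assms(1), of "{a, b, d}" w] assms by auto
  moreover have "count (ends G a) w > 0" "count (ends G b) w > 0" "count (ends G d) w > 0"
    using assms by auto
  ultimately show False by linarith
qed

lemma meets_class_closed:
  assumes "a \<in> T" "\<And>p q. p \<in> T \<Longrightarrow> (p, q) \<in> meets G W \<Longrightarrow> q \<in> T"
  shows "(meets G W)\<^sup>* `` {a} \<subseteq> T"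
proof
  fix b assume "b \<in> (meets G W)\<^sup>* `` {a}"
  then have "(a, b) \<in> (meets G W)\<^sup>*" by simp
  then show "b \<in> T" by induction (use assms in auto)
qed

lemma ends_eq_pair:
  assumes "size M = 2" "x \<in># M" "y \<in># M" "x \<noteq> y"
  shows "M = {#x, y#}"
proof -
  obtain N where N: "M = add_mset x N" using assms(2) by (metis insert_DiffM)
  then obtain N' where "N = add_mset y N'" using assms(3,4) by (metis insert_DiffM insert_noteq_member)
  then show ?thesis using N assms(1) by simp
qed

text \<open>The merged path is \<open>a, b\<close> or \<open>a, d, b\<close>, where \<open>d\<close> joins \<open>u\<close> and \<open>v\<close>.\<close>

lemma suppressed_path_closes_to_loop:
  fixes G :: "('v, 'e) multigraph"
  assumes fg: "finite_graph G" and nd: "no_dangling_edges G"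
    and deg: "degree G u = 2" "degree G v = 2"
    and ab: "a \<in> edges G" "b \<in> edges G" "a \<noteq> b" "x \<in># ends G a" "x \<in># ends G b" "x \<notin> {u, v}"
    and R: "(a, b) \<in> (meets G {u, v})\<^sup>*"
  shows "ends (suppress_vertices G {u, v}) ((meets G {u, v})\<^sup>* `` {a}) = {#x, x#}"
proof -
  let ?W = "{u, v}"
  let ?M = "meets G ?W"
  let ?C = "?M\<^sup>* `` {a}"
  have fin: "finite (edges G)" using fg by (simp add: finite_graph_def)
  have size2: "size (ends G e) = 2" if "e \<in> edges G" for e using nd that by (simp add: no_dangling_edges_def)
  have degW: "degree G w = 2" if "w \<in> ?W" for w using deg that by auto
  \<comment> \<open>The path from \<open>a\<close> to \<open>b\<close> leaves \<open>a\<close>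
    through a suppressed vertex \<open>w\<close> and enters \<open>b\<close> through a suppressed
    vertex \<open>w'\<close>.\<close>
  obtain w where w: "w \<in> ?W" "w \<in># ends G a"
    using R ab(3) by (cases rule: converse_rtranclE) (auto simp: meets_def)
  obtain w' where w': "w' \<in> ?W" "w' \<in># ends G b"
    using R ab(3) by (cases rule: rtranclE) (auto simp: meets_def)
  have xw: "x \<noteq> w" "x \<noteq> w'" using w w' ab(6) by auto
  have ea: "ends G a = {#x, w#}" using ends_eq_pair[OF size2[OF ab(1)]] ab w xw by blast
  have eb: "ends G b = {#x, w'#}" using ends_eq_pair[OF size2[OF ab(2)]] ab w' xw by blast
  have aC: "a \<in> ?C" and bC: "b \<in> ?C" using R by auto
  show ?thesis
  proof (cases "w = w'")
    case True
    \<comment> \<open>The edges \<open>a\<close> and \<open>b\<close> exhaust the two edge-ends at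
      \<open>w\<close>, so the path stops there.\<close>
    have "?C \<subseteq> {a, b}"
    proof (rule meets_class_closed)
      fix p q assume p: "p \<in> {a, b}" and "(p, q) \<in> ?M"
      then obtain z where z: "z \<in> ?W" "z \<in># ends G p" "z \<in># ends G q" "q \<in> edges G"
        by (auto simp: meets_def)
      have "z = w" using p z ea eb True ab(6) by auto
      then show "q \<in> {a, b}"
        using edges_at_degree_2[OF fin degW[OF w(1)] ab(1-3) _ _ z(4)] z w w' True by auto
    qed simp
    then have "?C = {a, b}" using aC bC by blast
    then show ?thesis using ab(3,6) w w' by (simp add: suppress_vertices_sel ea eb)
  next
    case False
    have W: "?W = {w, w'}" using False w w' by auto
    \<comment> \<open>Only one of the two edge-ends at \<open>w\<close> belongs to
      \<open>a\<close>.\<close>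
    have "\<exists>d\<in>edges G. d \<noteq> a \<and> w \<in># ends G d"
    proof (rule ccontr)
      assume "\<not> ?thesis"
      then have "(\<Sum>e\<in>edges G - {a}. count (ends G e) w) = 0"
        by (intro sum.neutral) (auto simp: count_eq_zero_iff)
      then have "degree G w = 1" using fin ab(1) xw by (simp add: degree_def sum.remove[of _ a] ea)
      then show False using degW[OF w(1)] by simp
    qed
    then obtain d where d: "d \<in> edges G" "d \<noteq> a" "w \<in># ends G d" by blast
    have db: "d \<noteq> b" using d(3) eb xw False by auto
    have at_w: "q = a \<or> q = d" if "q \<in> edges G" "w \<in># ends G q" for q
      using edges_at_degree_2[OF fin degW[OF w(1)] ab(1) d(1) _ w(2) d(3) that] d(2) by blast
    \<comment> \<open>Otherwise the class would close up as a subset of \<open>{a, d}\<close> and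
      never reach \<open>b\<close>.\<close>
    have dw': "w' \<in># ends G d"
    proof (rule ccontr)
      assume no: "w' \<notin># ends G d"
      have "?C \<subseteq> {a, d}"
      proof (rule meets_class_closed)
        fix p q assume p: "p \<in> {a, d}" and "(p, q) \<in> ?M"
        then obtain z where z: "z \<in> {w, w'}" "z \<in># ends G p" "z \<in># ends G q" "q \<in> edges G"
          unfolding W by (auto simp: meets_def)
        have "z = w" using p z ea no xw False by auto
        then show "q \<in> {a, d}" using at_w z by blast
      qed simp
      then show False using bC ab(3) db by auto
    qed
    have ed: "ends G d = {#w, w'#}" using ends_eq_pair[OF size2[OF d(1)] d(3) dw' False] .
    have at_w': "q = b \<or> q = d" if "q \<in> edges G" "w' \<in># ends G q" for q
      using edges_at_degree_2[OF fin degW[OF w'(1)] ab(2) d(1) _ w'(2) dw' that] db by blast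
    have "?C \<subseteq> {a, d, b}"
    proof (rule meets_class_closed)
      fix p q assume "p \<in> {a, d, b}" and "(p, q) \<in> ?M"
      then obtain z where z: "z \<in> {w, w'}" "z \<in># ends G q" "q \<in> edges G"
        unfolding W by (auto simp: meets_def)
      then show "q \<in> {a, d, b}" using at_w at_w' by blast
    qed simp
    moreover have "(a, d) \<in> ?M" using ab(1) d w by (auto simp: meets_def)
    ultimately have "?C = {a, d, b}" using aC bC by blast
    moreover have "(\<Sum>p\<in>{a, d, b}. filter_mset (\<lambda>y. y \<notin> {w, w'}) (ends G p)) = {#x, x#}"
      using ab(3) d(2) db xw by (simp add: ea eb ed)
    ultimately show ?thesis unfolding suppress_vertices_sel W by simp
  qed
qed

text \<open>Every edge inherits the colour of its class. Two edges meeting at \<open>x\<close>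
  outside \<open>{u, v}\<close> cannot lie in one class, since the merged edge would be a loop at
  \<open>x\<close> and a loop cannot be properly coloured. Their classes are thus adjacent and
  differ in colour.\<close>

lemma suppress_colourable_imp_remove_colourable:
  fixes G :: "('v, 'e) multigraph"
  assumes fg: "finite_graph G" and nd: "no_dangling_edges G"
    and deg: "degree G u = 2" "degree G v = 2"
    and col: "edge_colourable 3 (suppress_vertices G {u, v})"
  shows "edge_colourable 3 (remove_vertices G {u, v})"
proof -
  let ?W = "{u, v}"
  let ?R = "(meets G ?W)\<^sup>*" and ?Q = "suppress_vertices G ?W" and ?H = "remove_vertices G ?W"
  have fin: "finite (edges G)" using fg by (simp add: finite_graph_def)
  obtain k :: "'e set \<Rightarrow> nat" where k3: "\<forall>C\<in>edges ?Q. k C < 3"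
    and proper: "\<And>C C'. C \<in> edges ?Q \<Longrightarrow> C' \<in> edges ?Q \<Longrightarrow> adjacent_edges ?Q C C' \<Longrightarrow> k C \<noteq> k C'"
    using col unfolding edge_colourable_def by blast
  have cls: "?R `` {a} \<in> edges ?Q" if "a \<in> edges G" for a
    using that by (auto simp: suppress_vertices_sel intro: quotientI)
  have H: "edges ?H \<subseteq> edges G" "\<And>a. ends ?H a = filter_mset (\<lambda>x. x \<notin> ?W) (ends G a)"
    by (auto simp: remove_vertices_def)
  have noloop: "ends ?Q (?R `` {a}) \<noteq> {#x, x#}" if "a \<in> edges G" for a x
    using proper[OF cls[OF that] cls[OF that]] by (auto simp: adjacent_edges_def)
  have "k (?R `` {a}) \<noteq> k (?R `` {b})"
    if ab: "a \<in> edges ?H" "b \<in> edges ?H" and adj: "adjacent_edges ?H a b" for a b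
  proof (cases "a = b")
    case False
    then obtain x where x: "x \<in># ends G a" "x \<in># ends G b" "x \<notin> ?W"
      using adj by (auto simp: adjacent_edges_def H)
    have abG: "a \<in> edges G" "b \<in> edges G" using ab H by auto
    have "(a, b) \<notin> ?R"
      using suppressed_path_closes_to_loop[OF fg nd deg abG False x] noloop[OF abG(1)] by blast
    then have ne: "?R `` {a} \<noteq> ?R `` {b}" by blast
    have inc: "x \<in># ends ?Q (?R `` {p})" if "p \<in> edges G" "x \<in># ends G p" for p
    proof -
      have "finite (?R `` {p})" using finite_subset[OF meets_class_subset[OF that(1)] fin] .
      then show ?thesis using that x(3) by (auto simp: suppress_vertices_sel set_mset_sum)
    qed
    have "adjacent_edges ?Q (?R `` {a}) (?R `` {b})"
      unfolding adjacent_edges_def using ne inc abG x by blast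
    then show ?thesis using proper cls abG by blast
  next
    case True
    then obtain x where x: "ends ?H a = {#x, x#}" using adj by (auto simp: adjacent_edges_def)
    have aG: "a \<in> edges G" using ab H by auto
    have "x \<in># ends ?H a" using x by simp
    then have xW: "x \<notin> ?W" unfolding H(2) by simp
    have "count (ends ?H a) x = 2" using x by simp
    then have "count (ends G a) x = 2" using xW by (simp add: H)
    then have ea: "ends G a = {#x, x#}"
      using nd aG by (intro loop_if_count_ge_2) (auto simp: no_dangling_edges_def)
    \<comment> \<open>A loop that avoids the suppressed vertices forms a class of its own, so it
      would survive as a loop.\<close>
    have "?R `` {a} \<subseteq> {a}"
      by (rule meets_class_closed) (use ea xW in \<open>auto simp: meets_def\<close>)
    then have "?R `` {a} = {a}" by blast
    then have "ends ?Q (?R `` {a}) = {#x, x#}" using xW by (simp add: suppress_vertices_sel ea)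
    then show ?thesis using noloop[OF aG] by blast
  qed
  moreover have "\<forall>a\<in>edges ?H. k (?R `` {a}) < 3" using cls H k3 by blast
  ultimately show ?thesis unfolding edge_colourable_def
    by (intro exI[of _ "\<lambda>a. k (?R `` {a})"]) blast
qed

section \<open>Comparison of the six statements\<close>

lemma remove_colourable_iff_parity_colouring_off:
  assumes fg: "finite_graph G" and cub: "cubic G"
  shows "edge_colourable 3 (remove_vertices G S) \<longleftrightarrow> (\<exists>c. parity_colouring_off G S c)"
proof -
  have fin: "finite (edges G)" using fg by (simp add: finite_graph_def)
  \<comment> \<open>Edges leading to \<open>S\<close> survive as dangling edges, so the remaining
    vertices keep degree three.\<close>
  have "cubic (remove_vertices G S)"
    unfolding cubic_def
  proof
    fix x assume "x \<in> verts (remove_vertices G S)"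
    then have "x \<in> verts G" "x \<notin> S" by (auto simp: remove_vertices_def)
    then show "degree (remove_vertices G S) x = 3"
      using cub degree_remove[OF fin] by (simp add: cubic_def)
  qed
  then show ?thesis
    using edge_colourable_iff_parity_colouring[OF finite_graph_remove[OF fg]]
      parity_colouring_remove_iff[OF fg] by simp
qed

lemma flow_remove_iff_parity_colouring_off:
  assumes "finite_graph G"
  shows "has_nowhere_zero_flow 4 (remove_vertices G S) \<longleftrightarrow> (\<exists>c. parity_colouring_off G S c)"
  using nowhere_zero_4_flow_iff_parity_colouring[OF finite_graph_remove[OF assms]]
    parity_colouring_remove_iff[OF assms] by simp

lemma flow_identify_iff_parity_colouring_off:
  assumes "finite_graph G" "no_dangling_edges G" "S \<subseteq> verts G" "S \<noteq> {}"
  shows "has_nowhere_zero_flow 4 (identify_vertices G S) \<longleftrightarrow> (\<exists>c. parity_colouring_off G S c)"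
  using nowhere_zero_4_flow_iff_parity_colouring[OF finite_graph_identify[OF assms(1)]]
    parity_colouring_identify_iff[OF assms] by simp

lemma snark_edge_equivalences:
  fixes G :: "('v, 'e) multigraph"
  assumes G: "snark G" and e: "e \<in> edges G" "ends G e = {#u, v#}" and uv: "u \<noteq> v"
  shows "edge_colourable 3 (remove_vertices G {u, v}) \<longleftrightarrow> has_nowhere_zero_flow 4 (delete_edge G e)"
    (is ?iv)
    and "edge_colourable 3 (remove_vertices G {u, v}) \<longleftrightarrow> has_nowhere_zero_flow 4 (contract_edge G e)"
    (is ?v)
    and "edge_colourable 3 (remove_vertices G {u, v}) \<longleftrightarrow> edge_colourable 3 (delete_suppress G e)"
    (is ?vi)
proof -
  let ?S = "{u, v}"
  let ?H = "remove_vertices G ?S" and ?D = "delete_edge G e"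
  have fg: "finite_graph G" and nd: "no_dangling_edges G" and cub: "cubic G"
    using G by (auto simp: snark_def)
  have fin: "finite (edges G)" using fg by (simp add: finite_graph_def)
  have S: "?S \<subseteq> verts G" using fg e by (auto simp: finite_graph_def)
  have fgD: "finite_graph ?D" and ndD: "no_dangling_edges ?D"
    using fg nd by (auto simp: finite_graph_def no_dangling_edges_def)
  \<comment> \<open>The edge \<open>e\<close> disappears together with its ends in any case, so
    \<open>G\<close> may be replaced by \<open>?D\<close> in statement (i).\<close>
  have HD: "remove_vertices ?D ?S = ?H"
    using e by (auto simp: remove_vertices_def)
  have off: "edge_colourable 3 ?H \<longleftrightarrow> (\<exists>c. parity_colouring_off ?D ?S c)"
    using remove_colourable_iff_parity_colouring_off[OF fg cub, of ?S]
      parity_colouring_remove_iff[OF fg, of ?S] parity_colouring_remove_iff[OF fgD, of ?S] HD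
    by simp
  \<comment> \<open>From left to right the snark property forces the law at \<open>u\<close> and
    \<open>v\<close>; the converse merely forgets it there.\<close>
  have "(\<exists>c. parity_colouring_off ?D ?S c) \<longleftrightarrow> (\<exists>c. parity_colouring ?D c)"
    using snark_off_ends_imp_parity_colouring_delete[OF G e uv]
    unfolding parity_colouring_off_def parity_colouring_def by blast
  then have del: "edge_colourable 3 ?H \<longleftrightarrow> (\<exists>c. parity_colouring ?D c)" using off by simp
  then show ?iv
    using nowhere_zero_4_flow_iff_parity_colouring[OF fgD] by simp
  have "contract_edge G e = identify_vertices ?D ?S"
    using e by (simp add: contract_edge_def)
  then show ?v
    using off flow_identify_iff_parity_colouring_off[OF fgD ndD, of ?S] S by simp
  \<comment> \<open>Since \<open>e\<close> is not a loop, each of its ends loses exactly one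
    edge-end; hence precisely \<open>u\<close> and \<open>v\<close> get suppressed.\<close>
  have deg: "degree ?D x = (if x \<in> ?S then 2 else 3)" if "x \<in> verts G" for x
    using degree_delete_edge[OF fin e(1), of x] cub that uv e(2) by (auto simp: cubic_def)
  then have "{x \<in> verts G. degree ?D x = 2} = ?S" using S by (auto split: if_splits)
  then have Q: "delete_suppress G e = suppress_vertices ?D ?S" by (simp add: delete_suppress_def)
  show ?vi
  proof
    assume "edge_colourable 3 ?H"
    then obtain c where "parity_colouring ?D c" using del by blast
    then show "edge_colourable 3 (delete_suppress G e)"
      unfolding Q using deg S by (intro parity_colouring_imp_suppress_colourable[OF fgD]) auto
  next
    assume "edge_colourable 3 (delete_suppress G e)"
    then have "edge_colourable 3 (remove_vertices ?D ?S)"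
      unfolding Q using deg S
      by (intro suppress_colourable_imp_remove_colourable[OF fgD ndD]) auto
    then show "edge_colourable 3 ?H" unfolding HD .
  qed
qed

theorem theorem3:
  fixes G :: "('v, 'e) multigraph" and u v :: 'v
  assumes "snark G" and "u \<in> verts G" and "v \<in> verts G" and "u \<noteq> v"
  shows "((edge_colourable 3 (remove_vertices G {u, v}) \<longleftrightarrow>
            has_nowhere_zero_flow 4 (remove_vertices G {u, v})) \<and>
          (edge_colourable 3 (remove_vertices G {u, v}) \<longleftrightarrow>
            has_nowhere_zero_flow 4 (identify_vertices G {u, v}))) \<and>
         (\<forall>e \<in> edges G. ends G e = {#u, v#} \<longrightarrow>
           (edge_colourable 3 (remove_vertices G {u, v}) \<longleftrightarrow>
             has_nowhere_zero_flow 4 (delete_edge G e)) \<and>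
           (edge_colourable 3 (remove_vertices G {u, v}) \<longleftrightarrow>
             has_nowhere_zero_flow 4 (contract_edge G e)) \<and>
           (edge_colourable 3 (remove_vertices G {u, v}) \<longleftrightarrow>
             edge_colourable 3 (delete_suppress G e)))"
proof -
  let ?S = "{u, v}"
  have fg: "finite_graph G" and nd: "no_dangling_edges G" and cub: "cubic G"
    using assms(1) by (auto simp: snark_def)
  have S: "?S \<subseteq> verts G" "?S \<noteq> {}" using assms by auto
  note col = remove_colourable_iff_parity_colouring_off[OF fg cub, of ?S]
  have "edge_colourable 3 (remove_vertices G ?S) \<longleftrightarrow>
      has_nowhere_zero_flow 4 (remove_vertices G ?S)"
    unfolding col using flow_remove_iff_parity_colouring_off[OF fg] by simp
  moreover have "edge_colourable 3 (remove_vertices G ?S) \<longleftrightarrow>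
      has_nowhere_zero_flow 4 (identify_vertices G ?S)"
    unfolding col using flow_identify_iff_parity_colouring_off[OF fg nd S] by simp
  ultimately show ?thesis
    using snark_edge_equivalences[OF assms(1) _ _ assms(4)] by blast
qed

end
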